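(* Let $n\ge2$, $\hbar>0$ and $q=e^{i\pi\hbar}$. Consider the abstract quantum algebra (associative, unital, over $\mathbb C$) with generators $a_i,b_i,c_i$, $i=1,\dots,n-1$, and defining relations: for each $i$, $$qa_ib_i=q^{-1}b_ia_i,\qquad q^{-1}a_ic_i=qc_ia_i,\qquad b_ic_i=q^2a_i^2+1,\qquad c_ib_i=q^{-2}a_i^2+1,$$ and for all $i<j$, \begin{align*} & q^{-1}b_ib_j=qb_jb_i,\qquad q^{-1}c_ic_j=qc_jc_i,\qquad a_ib_j=b_ja_i,\qquad c_ia_j=a_jc_i,\qquad qc_ib_j=q^{-1}b_jc_i,\\ & b_ia_j=a_jb_i+(q^2-q^{-2})a_ib_j,\qquad a_ic_j=c_ja_i+(q^2-q^{-2})c_ia_j,\\ & a_ia_j=a_ja_i+(q^2-1)c_ib_j,\\ & qb_ic_j+q(q^{-2}-q^{2})a_ia_j=q^{-1}c_jb_i-q^{-1}(q^{-2}-q^{2})a_ja_i . \end{align*} These relations satisfy the quantum Jacobi relation: for any three generators $x,y,z$, the two ways of reordering the triple product $xyz$ by means of the relations (starting with the pair $xy$ or starting with the pair $yz$) yield the same linear combination of ordered monomials.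
   Context: Reordering convention: a word is ordered if generators with smaller index stand to the left of those with larger index and, within each index $i$, the generators appear as $a_i^kb_i^l$ or $a_i^kc_i^l$ with $k,l\ge0$. The relations are used as rewriting rules bringing words to combinations of ordered words: for equal indices $b_ia_i\to q^2a_ib_i$, $c_ia_i\to q^{-2}a_ic_i$, $b_ic_i\to q^2a_i^2+1$, $c_ib_i\to q^{-2}a_i^2+1$; for $i<j$ each product (generator with index $j$)(generator with index $i$) is expressed through products (generator with index $i$)(generator with index $j$) by the relations above; e.g. $a_ja_i\to a_ia_j-(q^2-1)c_ib_j$, $a_jb_i\to b_ia_j-(q^2-q^{-2})a_ib_j$, $c_ja_i\to a_ic_j-(q^2-q^{-2})c_ia_j$, and $c_jb_i\to q^2b_ic_j+q^2(q^{-2}-q^2)a_ia_j+(q^{-2}-q^2)\left(a_ia_j-(q^2-1)c_ib_j\right)$. *)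

theory Defs
  imports Complex_Main "HOL-Library.Poly_Mapping"
begin

datatype gen = A nat | B nat | C nat

fun index :: "gen \<Rightarrow> nat" where
  "index (A i) = i"
| "index (B i) = i"
| "index (C i) = i"

definition generators :: "nat \<Rightarrow> gen set" where
  "generators n = {g. 1 \<le> index g \<and> index g \<le> n - 1}"

text \<open>
  With concatenation as the (additively written) monoid operation on words, the ring structure of
  \<^typ>\<open>'a list \<Rightarrow>\<^sub>0 complex\<close> from \<^theory>\<open>HOL-Library.Poly_Mapping\<close> is the free associative
  unital complex algebra on the generating set.
\<close>

instantiation list :: (type) monoid_add
begin
definition zero_list :: "'a list" where "zero_list = []"
definition plus_list :: "'a list \<Rightarrow> 'a list \<Rightarrow> 'a list" where "plus_list = (@)"
instance by standard (simp_all add: zero_list_def plus_list_def)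
end

type_synonym free_alg = "gen list \<Rightarrow>\<^sub>0 complex"

abbreviation scaled_word :: "complex \<Rightarrow> gen list \<Rightarrow> free_alg" (infix \<open>\<star>\<close> 75) where
  "c \<star> w \<equiv> Poly_Mapping.single w c"

abbreviation word :: "gen list \<Rightarrow> free_alg" where
  "word w \<equiv> 1 \<star> w"

abbreviation smul :: "complex \<Rightarrow> free_alg \<Rightarrow> free_alg" (infixr \<open>\<cdot>\<close> 75) where
  "c \<cdot> p \<equiv> Poly_Mapping.map ((*) c) p"

lemma lookup_smul: "Poly_Mapping.lookup (c \<cdot> p) w = c * Poly_Mapping.lookup p w"
  by (simp add: Poly_Mapping.map.rep_eq when_def)

interpretation free_alg: module smul
  by standard (auto intro!: poly_mapping_eqI simp: lookup_add lookup_smul algebra_simps)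

inductive_set relations :: "nat \<Rightarrow> complex \<Rightarrow> (free_alg \<times> free_alg) set"
  for n :: nat and q :: complex where
  ab: "\<lbrakk>1 \<le> i; i \<le> n - 1\<rbrakk> \<Longrightarrow>
    (q \<star> [A i, B i], inverse q \<star> [B i, A i]) \<in> relations n q"
| ac: "\<lbrakk>1 \<le> i; i \<le> n - 1\<rbrakk> \<Longrightarrow>
    (inverse q \<star> [A i, C i], q \<star> [C i, A i]) \<in> relations n q"
| bc: "\<lbrakk>1 \<le> i; i \<le> n - 1\<rbrakk> \<Longrightarrow>
    (word [B i, C i], q^2 \<star> [A i, A i] + word []) \<in> relations n q"
| cb: "\<lbrakk>1 \<le> i; i \<le> n - 1\<rbrakk> \<Longrightarrow>
    (word [C i, B i], inverse (q^2) \<star> [A i, A i] + word []) \<in> relations n q"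
| bb': "\<lbrakk>1 \<le> i; i < j; j \<le> n - 1\<rbrakk> \<Longrightarrow>
    (inverse q \<star> [B i, B j], q \<star> [B j, B i]) \<in> relations n q"
| cc': "\<lbrakk>1 \<le> i; i < j; j \<le> n - 1\<rbrakk> \<Longrightarrow>
    (inverse q \<star> [C i, C j], q \<star> [C j, C i]) \<in> relations n q"
| ab': "\<lbrakk>1 \<le> i; i < j; j \<le> n - 1\<rbrakk> \<Longrightarrow>
    (word [A i, B j], word [B j, A i]) \<in> relations n q"
| ca': "\<lbrakk>1 \<le> i; i < j; j \<le> n - 1\<rbrakk> \<Longrightarrow>
    (word [C i, A j], word [A j, C i]) \<in> relations n q"
| cb': "\<lbrakk>1 \<le> i; i < j; j \<le> n - 1\<rbrakk> \<Longrightarrow>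
    (q \<star> [C i, B j], inverse q \<star> [B j, C i]) \<in> relations n q"
| ba': "\<lbrakk>1 \<le> i; i < j; j \<le> n - 1\<rbrakk> \<Longrightarrow>
    (word [B i, A j], word [A j, B i] + (q^2 - inverse (q^2)) \<star> [A i, B j]) \<in> relations n q"
| ac': "\<lbrakk>1 \<le> i; i < j; j \<le> n - 1\<rbrakk> \<Longrightarrow>
    (word [A i, C j], word [C j, A i] + (q^2 - inverse (q^2)) \<star> [C i, A j]) \<in> relations n q"
| aa': "\<lbrakk>1 \<le> i; i < j; j \<le> n - 1\<rbrakk> \<Longrightarrow>
    (word [A i, A j], word [A j, A i] + (q^2 - 1) \<star> [C i, B j]) \<in> relations n q"
| bc': "\<lbrakk>1 \<le> i; i < j; j \<le> n - 1\<rbrakk> \<Longrightarrow>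
    (q \<star> [B i, C j] + (q * (inverse (q^2) - q^2)) \<star> [A i, A j],
     inverse q \<star> [C j, B i] - (inverse q * (inverse (q^2) - q^2)) \<star> [A j, A i]) \<in> relations n q"

definition ordered_word :: "gen list \<Rightarrow> bool" where
  "ordered_word w \<longleftrightarrow> sorted (map index w) \<and>
     (\<forall>i. \<exists>k l. filter (\<lambda>g. index g = i) w = replicate k (A i) @ replicate l (B i) \<or>
                 filter (\<lambda>g. index g = i) w = replicate k (A i) @ replicate l (C i))"

definition ordered :: "free_alg \<Rightarrow> bool" where
  "ordered p \<longleftrightarrow> (\<forall>w \<in> Poly_Mapping.keys p. ordered_word w)"

text \<open>
  The rewriting rules are the relations solved for the unordered two-letter words. Using the linear
  span matters only for \<open>[C j, B i]\<close> with \<open>i < j\<close>, where two relations have to be combined; the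
  resulting explicit rules are derived below.
\<close>

definition rewrite_rule :: "(free_alg \<times> free_alg) set \<Rightarrow> gen list \<Rightarrow> free_alg \<Rightarrow> bool" where
  "rewrite_rule R w p \<longleftrightarrow> length w = 2 \<and> \<not> ordered_word w \<and> ordered p \<and>
     word w - p \<in> free_alg.span {l - r | l r. (l, r) \<in> R}"

inductive rewrite_step :: "(free_alg \<times> free_alg) set \<Rightarrow> free_alg \<Rightarrow> free_alg \<Rightarrow> bool"
  for R :: "(free_alg \<times> free_alg) set" where
  "\<lbrakk>rewrite_rule R w p; c = Poly_Mapping.lookup f (u @ w @ v); c \<noteq> 0\<rbrakk> \<Longrightarrow>
    rewrite_step R f (f - c \<star> (u @ w @ v) + c \<cdot> (word u * p * word v))"

definition reorders_to :: "(free_alg \<times> free_alg) set \<Rightarrow> free_alg \<Rightarrow> free_alg \<Rightarrow> bool" where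
  "reorders_to R f g \<longleftrightarrow> (rewrite_step R)\<^sup>*\<^sup>* f g \<and> ordered g"

definition reorders_left_first ::
  "(free_alg \<times> free_alg) set \<Rightarrow> gen \<Rightarrow> gen \<Rightarrow> gen \<Rightarrow> free_alg \<Rightarrow> bool" where
  "reorders_left_first R x y z r \<longleftrightarrow>
     (\<exists>p. reorders_to R (word [x, y]) p \<and> reorders_to R (p * word [z]) r)"

definition reorders_right_first ::
  "(free_alg \<times> free_alg) set \<Rightarrow> gen \<Rightarrow> gen \<Rightarrow> gen \<Rightarrow> free_alg \<Rightarrow> bool" where
  "reorders_right_first R x y z r \<longleftrightarrow>
     (\<exists>p. reorders_to R (word [y, z]) p \<and> reorders_to R (word [x] * p) r)"

text \<open>
  Reordering is nondeterministic, so the condition includes that either way has exactly one result.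
\<close>

definition quantum_jacobi :: "gen set \<Rightarrow> (free_alg \<times> free_alg) set \<Rightarrow> bool" where
  "quantum_jacobi G R \<longleftrightarrow> (\<forall>x\<in>G. \<forall>y\<in>G. \<forall>z\<in>G. \<exists>r.
     {s. reorders_left_first R x y z s} = {r} \<and> {s. reorders_right_first R x y z s} = {r})"


subsection \<open>The rules in solved form\<close>

lemma ordered_word_pair:
  "ordered_word [x, y] \<longleftrightarrow>
     index x < index y \<or> x = y \<or> (\<exists>i. x = A i \<and> (y = B i \<or> y = C i))"
proof
  assume o: "ordered_word [x, y]"
  show "index x < index y \<or> x = y \<or> (\<exists>i. x = A i \<and> (y = B i \<or> y = C i))"
  proof (cases "index x = index y")
    case True
    then have "filter (\<lambda>g. index g = index y) [x, y] = [x, y]"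
      by simp
    with o obtain k l where kl:
      "[x, y] = replicate k (A (index y)) @ replicate l (B (index y)) \<or>
       [x, y] = replicate k (A (index y)) @ replicate l (C (index y))"
      unfolding ordered_word_def by metis
    then have "length [x, y] = k + l"
      by (metis length_append length_replicate)
    then have "k = 0 \<and> l = 2 \<or> k = 1 \<and> l = 1 \<or> k = 2 \<and> l = 0"
      by simp linarith
    with kl show ?thesis
      by (auto simp: numeral_2_eq_2)
  next
    case False
    then show ?thesis using o by (auto simp: ordered_word_def)
  qed
next
  define S where "S i w \<longleftrightarrow> (\<exists>k l. w = replicate k (A i) @ replicate l (B i) \<or>
    w = replicate k (A i) @ replicate l (C i))" for i w
  have S: "S i (replicate k (A i) @ replicate l (B i))"
    "S i (replicate k (A i) @ replicate l (C i))" for i k l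
    by (auto simp: S_def)
  have S': "S i []" "S i [A i]" "S i [B i]" "S i [C i]" "S i [A i, A i]" "S i [B i, B i]"
    "S i [C i, C i]" "S i [A i, B i]" "S i [A i, C i]" for i
    using S(1)[of i 0 0] S(1)[of i 1 0] S(1)[of i 0 1] S(2)[of i 0 1] S(1)[of i 2 0]
      S(1)[of i 0 2] S(2)[of i 0 2] S(1)[of i 1 1] S(2)[of i 1 1]
    by (simp_all add: numeral_2_eq_2)
  assume "index x < index y \<or> x = y \<or> (\<exists>i. x = A i \<and> (y = B i \<or> y = C i))"
  then show "ordered_word [x, y]"
    unfolding ordered_word_def S_def[symmetric] by (cases x; cases y) (auto simp: S')
qed

lemma ordered_word_Nil: "ordered_word []"
  by (simp add: ordered_word_def)

lemma ordered_scaled_word: "ordered_word w \<Longrightarrow> ordered (c \<star> w)"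
  by (auto simp: ordered_def)

lemma ordered_add: "ordered p \<Longrightarrow> ordered p' \<Longrightarrow> ordered (p + p')"
  using keys_add[of p p'] by (auto simp: ordered_def)

lemma rewrite_rule_relation:
  assumes "(l, r) \<in> R" "length w = 2" "\<not> ordered_word w" "ordered p"
    and "word w - p = k \<cdot> (l - r)"
  shows "rewrite_rule R w p"
  unfolding rewrite_rule_def assms(5)
  using assms(1-4) by (blast intro: free_alg.span_scale free_alg.span_base)

lemma rewrite_rule_relation2:
  assumes "(l, r) \<in> R" "(l', r') \<in> R" "length w = 2" "\<not> ordered_word w" "ordered p"
    and "word w - p = k \<cdot> (l - r) + k' \<cdot> (l' - r')"
  shows "rewrite_rule R w p"
  unfolding rewrite_rule_def assms(6)
  using assms(1-5) by (blast intro: free_alg.span_add free_alg.span_scale free_alg.span_base)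

lemmas pair_simps = ordered_word_pair ordered_word_Nil ordered_scaled_word ordered_add
lemmas coeff_simps = lookup_add lookup_minus lookup_single when_def lookup_smul

lemma rewrite_rules_equal_index:
  assumes q: "q \<noteq> 0" and i: "1 \<le> i" "i \<le> n - 1"
  shows "rewrite_rule (relations n q) [B i, A i] (q^2 \<star> [A i, B i])"
    and "rewrite_rule (relations n q) [C i, A i] (inverse (q^2) \<star> [A i, C i])"
    and "rewrite_rule (relations n q) [B i, C i] (q^2 \<star> [A i, A i] + word [])"
    and "rewrite_rule (relations n q) [C i, B i] (inverse (q^2) \<star> [A i, A i] + word [])"
  subgoal
    by (rule rewrite_rule_relation[where k = "- q", OF relations.ab[OF i]])
       (use q in \<open>auto simp: pair_simps coeff_simps field_simps power2_eq_square
          intro!: poly_mapping_eqI\<close>)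
  subgoal
    by (rule rewrite_rule_relation[where k = "- inverse q", OF relations.ac[OF i]])
       (use q in \<open>auto simp: pair_simps coeff_simps field_simps power2_eq_square
          intro!: poly_mapping_eqI\<close>)
  subgoal
    by (rule rewrite_rule_relation[where k = 1, OF relations.bc[OF i]])
       (auto simp: pair_simps coeff_simps intro!: poly_mapping_eqI)
  subgoal
    by (rule rewrite_rule_relation[where k = 1, OF relations.cb[OF i]])
       (auto simp: pair_simps coeff_simps intro!: poly_mapping_eqI)
  done

lemma rewrite_rules_unequal_index:
  assumes q: "q \<noteq> 0" and ij: "1 \<le> i" "i < j" "j \<le> n - 1"
  shows "rewrite_rule (relations n q) [B j, B i] (inverse (q^2) \<star> [B i, B j])"
    and "rewrite_rule (relations n q) [C j, C i] (inverse (q^2) \<star> [C i, C j])"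
    and "rewrite_rule (relations n q) [B j, A i] (word [A i, B j])"
    and "rewrite_rule (relations n q) [A j, C i] (word [C i, A j])"
    and "rewrite_rule (relations n q) [B j, C i] (q^2 \<star> [C i, B j])"
    and "rewrite_rule (relations n q) [A j, B i]
           (word [B i, A j] + (- (q^2 - inverse (q^2))) \<star> [A i, B j])"
    and "rewrite_rule (relations n q) [C j, A i]
           (word [A i, C j] + (- (q^2 - inverse (q^2))) \<star> [C i, A j])"
    and "rewrite_rule (relations n q) [A j, A i] (word [A i, A j] + (- (q^2 - 1)) \<star> [C i, B j])"
    and "rewrite_rule (relations n q) [C j, B i]
           (q^2 \<star> [B i, C j] + (q^2 * (inverse (q^2) - q^2)) \<star> [A i, A j] +
            (inverse (q^2) - q^2) \<cdot> (word [A i, A j] + (- (q^2 - 1)) \<star> [C i, B j]))"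
  subgoal
    by (rule rewrite_rule_relation[where k = "- inverse q", OF relations.bb'[OF ij]])
       (use q ij in \<open>auto simp: pair_simps coeff_simps field_simps power2_eq_square
          intro!: poly_mapping_eqI\<close>)
  subgoal
    by (rule rewrite_rule_relation[where k = "- inverse q", OF relations.cc'[OF ij]])
       (use q ij in \<open>auto simp: pair_simps coeff_simps field_simps power2_eq_square
          intro!: poly_mapping_eqI\<close>)
  subgoal
    by (rule rewrite_rule_relation[where k = "- 1", OF relations.ab'[OF ij]])
       (use ij in \<open>auto simp: pair_simps coeff_simps intro!: poly_mapping_eqI\<close>)
  subgoal
    by (rule rewrite_rule_relation[where k = "- 1", OF relations.ca'[OF ij]])
       (use ij in \<open>auto simp: pair_simps coeff_simps intro!: poly_mapping_eqI\<close>)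
  subgoal
    by (rule rewrite_rule_relation[where k = "- q", OF relations.cb'[OF ij]])
       (use q ij in \<open>auto simp: pair_simps coeff_simps field_simps power2_eq_square
          intro!: poly_mapping_eqI\<close>)
  subgoal
    by (rule rewrite_rule_relation[where k = "- 1", OF relations.ba'[OF ij]])
       (use ij in \<open>auto simp: pair_simps coeff_simps intro!: poly_mapping_eqI\<close>)
  subgoal
    by (rule rewrite_rule_relation[where k = "- 1", OF relations.ac'[OF ij]])
       (use ij in \<open>auto simp: pair_simps coeff_simps intro!: poly_mapping_eqI\<close>)
  subgoal
    by (rule rewrite_rule_relation[where k = "- 1", OF relations.aa'[OF ij]])
       (use ij in \<open>auto simp: pair_simps coeff_simps intro!: poly_mapping_eqI\<close>)
  subgoal
    by (rule rewrite_rule_relation2[where k = "- q" and k' = "- (inverse (q^2) - q^2)",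
          OF relations.bc'[OF ij] relations.aa'[OF ij]])
       (use q ij in \<open>auto simp: pair_simps coeff_simps free_alg.scale_right_distrib field_simps
          power2_eq_square intro!: poly_mapping_eqI\<close>)
  done

end

theory Submission
  imports Defs
begin

text \<open>
  Let \<open>L\<close> and \<open>R\<close> be the linear operators that apply the rules to the letters at positions \<open>0, 1\<close>
  and \<open>1, 2\<close> of every word of length at most three. Both are idempotent, and they satisfy the braid
  identity \<open>L R L R = R L R L\<close>, which is checked on each three-letter word. So \<open>N = L R L R\<close> absorbs
  \<open>L\<close> and \<open>R\<close> on both sides: its values are ordered and it is unchanged by every rewriting step.
  Since such an element rewrites to its images under \<open>L\<close> and \<open>R\<close>, its unique reordering is its
  image under \<open>N\<close>; this holds however the reordering starts. The rules themselves are unique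
  because \<open>L\<close> kills the span of the relations and fixes all ordered elements.
\<close>

section \<open>Explicit right-hand sides for pairs of letters\<close>

text \<open>The parameters \<open>s\<close> and \<open>t\<close> stand for \<open>q\<^sup>2\<close> and \<open>q\<^sup>-\<^sup>2\<close>.\<close>

fun equal_index_rule :: "complex \<Rightarrow> complex \<Rightarrow> gen \<Rightarrow> gen \<Rightarrow> free_alg" where
  "equal_index_rule s t (B i) (A _) = s \<star> [A i, B i]"
| "equal_index_rule s t (C i) (A _) = t \<star> [A i, C i]"
| "equal_index_rule s t (B i) (C _) = s \<star> [A i, A i] + word []"
| "equal_index_rule s t (C i) (B _) = t \<star> [A i, A i] + word []"
| "equal_index_rule s t x y = word [x, y]"

fun greater_index_rule :: "complex \<Rightarrow> complex \<Rightarrow> gen \<Rightarrow> gen \<Rightarrow> free_alg" where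
  "greater_index_rule s t (A j) (A i) = word [A i, A j] + (1 - s) \<star> [C i, B j]"
| "greater_index_rule s t (A j) (B i) = word [B i, A j] + (t - s) \<star> [A i, B j]"
| "greater_index_rule s t (A j) (C i) = word [C i, A j]"
| "greater_index_rule s t (B j) (A i) = word [A i, B j]"
| "greater_index_rule s t (B j) (B i) = t \<star> [B i, B j]"
| "greater_index_rule s t (B j) (C i) = s \<star> [C i, B j]"
| "greater_index_rule s t (C j) (A i) = word [A i, C j] + (t - s) \<star> [C i, A j]"
\<comment> \<open>Solving the mixed relation leaves \<open>A j A i\<close>, which is reordered here
  as well. Collecting \<open>s * (t - s)\<close> and \<open>t - s\<close> gives the coefficient of
  \<open>A i A j\<close>.\<close>
| "greater_index_rule s t (C j) (B i) =
     s \<star> [B i, C j] + ((s + 1) * (t - s)) \<star> [A i, A j] + ((t - s) * (1 - s)) \<star> [C i, B j]"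
| "greater_index_rule s t (C j) (C i) = t \<star> [C i, C j]"

definition rule :: "complex \<Rightarrow> complex \<Rightarrow> gen \<Rightarrow> gen \<Rightarrow> free_alg" where
  "rule s t x y = (if index x < index y then word [x, y]
     else if index x = index y then equal_index_rule s t x y else greater_index_rule s t x y)"

section \<open>Linear extension of maps on words\<close>

definition linear_extension :: "(gen list \<Rightarrow> free_alg) \<Rightarrow> free_alg \<Rightarrow> free_alg" where
  "linear_extension T f = (\<Sum>w\<in>Poly_Mapping.keys f. Poly_Mapping.lookup f w \<cdot> T w)"

text \<open>Words outside the support contribute zero. Elements with different supports can thus be
  summed over a common index set, which yields additivity.\<close>

lemma linear_extension_superset:
  assumes "finite S" "Poly_Mapping.keys f \<subseteq> S"
  shows "linear_extension T f = (\<Sum>w\<in>S. Poly_Mapping.lookup f w \<cdot> T w)"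
  unfolding linear_extension_def using assms
  by (intro sum.mono_neutral_left) (auto simp: in_keys_iff)

lemma linear_extension_add:
  "linear_extension T (f + g) = linear_extension T f + linear_extension T g"
proof -
  let ?S = "Poly_Mapping.keys f \<union> Poly_Mapping.keys g"
  show ?thesis
    using keys_add[of f g]
    by (simp add: linear_extension_superset[of ?S] lookup_add free_alg.scale_left_distrib
      sum.distrib)
qed

lemma keys_smul: "Poly_Mapping.keys (c \<cdot> f) \<subseteq> Poly_Mapping.keys f"
  by (auto simp: in_keys_iff lookup_smul)

lemma linear_extension_smul: "linear_extension T (c \<cdot> f) = c \<cdot> linear_extension T f"
  by (simp add: linear_extension_superset[OF _ keys_smul] linear_extension_def[of T f]
      free_alg.scale_sum_right free_alg.scale_scale lookup_smul)

lemma linear_extension_scaled_word: "linear_extension T (c \<star> w) = c \<cdot> T w"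
  by (subst linear_extension_superset[of "{w}"]) auto

section \<open>Rewriting at a fixed position and the braid identity\<close>

text \<open>Words too short for a pair at position \<open>k\<close> are fixed, so the operator is
  total; this matters because some rules produce the empty word and shorten their input.\<close>

definition rewrite_at :: "complex \<Rightarrow> complex \<Rightarrow> nat \<Rightarrow> gen list \<Rightarrow> free_alg" where
  "rewrite_at s t k w = (if k + 2 \<le> length w
     then word (take k w) * rule s t (w ! k) (w ! Suc k) * word (drop (k + 2) w) else word w)"

abbreviation "rewrite_all s t k \<equiv> linear_extension (rewrite_at s t k)"

lemma word_mult_scaled_word: "(c \<star> u) * (d \<star> v) = (c * d) \<star> (u @ v)"
  by (simp add: mult_single plus_list_def)

lemma smul_scaled_word: "c \<cdot> (d \<star> u) = (c * d) \<star> u"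
  by (auto intro!: poly_mapping_eqI simp: lookup_smul lookup_single when_def)

text \<open>
  An opaque indicator, so that the simplifier treats distinct words as independent atoms in
  coefficientwise identities instead of comparing them.
\<close>

definition delta :: "gen list \<Rightarrow> gen list \<Rightarrow> complex" where
  "delta u v = (if u = v then 1 else 0)"

lemma lookup_scaled_word: "Poly_Mapping.lookup (c \<star> u) v = c * delta u v"
  by (auto simp: delta_def lookup_single)

lemma word_Nil: "word [] = 1"
  by (simp flip: zero_list_def)

lemma rewrite_at_simps:
  "rewrite_at s t 0 [x] = word [x]"
  "rewrite_at s t (Suc 0) [x] = word [x]"
  "rewrite_at s t 0 [x, y, z] = rule s t x y * word [z]"
  "rewrite_at s t (Suc 0) [x, y, z] = word [x] * rule s t y z"
  by (simp_all add: rewrite_at_def word_Nil)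

lemmas rewrite_simps = rule_def rewrite_at_simps linear_extension_add linear_extension_scaled_word
  free_alg.scale_right_distrib smul_scaled_word word_mult_scaled_word
  distrib_left[where 'a=free_alg] distrib_right[where 'a=free_alg]

text \<open>A finite computation: both sides are expanded and compared coefficient by coefficient
  for all types of letters and all relative positions of the indices.\<close>

lemma braid_letters:
  assumes "s * t = 1"
  shows "rewrite_all s t 0 (rewrite_all s t 1 (rewrite_all s t 0 (rewrite_all s t 1 (word [x, y, z]))))
    = rewrite_all s t 1 (rewrite_all s t 0 (rewrite_all s t 1 (rewrite_all s t 0 (word [x, y, z]))))"
proof -
  \<comment> \<open>\<open>algebra_simps\<close> nests products to the right, where
    \<open>s * t\<close> need not occur as a subterm.\<close>
  have s: "s * (t * x) = x" for x using assms by (simp flip: mult.assoc)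
  show ?thesis
  \<comment> \<open>\<open>rule\<close> compares indices and rewriting interchanges letters, so all
    three pairs of indices are compared in advance.\<close>
  proof (cases "index x" "index y" rule: linorder_cases;
      cases "index y" "index z" rule: linorder_cases;
      cases "index x" "index z" rule: linorder_cases;
      rule poly_mapping_eqI)
  qed (cases x; cases y; cases z;
     simp add: rewrite_simps lookup_add lookup_scaled_word algebra_simps assms s)+
qed

section \<open>Composition and supports of linear extensions\<close>

lemma linear_extension_diff:
  "linear_extension T (f - g) = linear_extension T f - linear_extension T g"
  using linear_extension_add[of T "f - g" g] by (simp add: algebra_simps)

lemma linear_extension_sum:
  "linear_extension T (\<Sum>w\<in>S. f w) = (\<Sum>w\<in>S. linear_extension T (f w))"
proof (induction S rule: infinite_finite_induct)
  case (insert w S)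
  then show ?case by (simp add: linear_extension_add)
qed (simp_all add: linear_extension_def)

text \<open>A composition is again a linear extension, so an identity between composed operators can
  be checked word by word.\<close>

lemma linear_extension_compose:
  "linear_extension T (linear_extension U f) = linear_extension (\<lambda>w. linear_extension T (U w)) f"
  unfolding linear_extension_def[of U f] linear_extension_def[of "\<lambda>w. linear_extension T (U w)" f]
  by (simp add: linear_extension_sum linear_extension_smul)

lemma linear_extension_cong:
  "(\<And>w. w \<in> Poly_Mapping.keys f \<Longrightarrow> T w = U w) \<Longrightarrow> linear_extension T f = linear_extension U f"
  by (simp add: linear_extension_def)

lemma linear_extension_word [simp]: "linear_extension T (word w) = T w"
  by (simp add: linear_extension_scaled_word)

lemma linear_extension_id:
  assumes "\<And>w. w \<in> Poly_Mapping.keys f \<Longrightarrow> T w = word w"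
  shows "linear_extension T f = f"
proof (rule poly_mapping_eqI)
  fix v
  have "linear_extension T f = (\<Sum>w\<in>Poly_Mapping.keys f. Poly_Mapping.lookup f w \<star> w)"
    using assms by (simp add: linear_extension_def smul_scaled_word)
  then show "Poly_Mapping.lookup (linear_extension T f) v = Poly_Mapping.lookup f v"
    by (simp add: lookup_sum lookup_single when_def in_keys_iff)
qed

lemma keys_linear_extension:
  "Poly_Mapping.keys (linear_extension T f) \<subseteq> (\<Union>w\<in>Poly_Mapping.keys f. Poly_Mapping.keys (T w))"
proof
  fix v
  assume "v \<in> Poly_Mapping.keys (linear_extension T f)"
  then have "(\<Sum>w\<in>Poly_Mapping.keys f. Poly_Mapping.lookup f w * Poly_Mapping.lookup (T w) v) \<noteq> 0"
    by (simp add: linear_extension_def in_keys_iff lookup_sum lookup_smul)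
  then obtain w where "w \<in> Poly_Mapping.keys f" "Poly_Mapping.lookup (T w) v \<noteq> 0"
    by (metis (no_types, lifting) mult_eq_0_iff sum.neutral)
  then show "v \<in> (\<Union>w\<in>Poly_Mapping.keys f. Poly_Mapping.keys (T w))"
    by (auto simp: in_keys_iff)
qed

section \<open>Reducible positions and the support of a rewritten word\<close>

definition reducible_at :: "nat \<Rightarrow> gen list \<Rightarrow> bool" where
  "reducible_at k w \<longleftrightarrow> k + 2 \<le> length w \<and> \<not> ordered_word [w ! k, w ! Suc k]"

lemma rule_ordered: "ordered_word [x, y] \<Longrightarrow> rule s t x y = word [x, y]"
  by (cases x; cases y) (auto simp: ordered_word_pair rule_def)

lemma split_at: "k + 2 \<le> length w \<Longrightarrow> take k w @ [w ! k, w ! Suc k] @ drop (k + 2) w = w"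
  by (simp add: Cons_nth_drop_Suc)

lemma rewrite_at_irreducible:
  assumes "\<not> reducible_at k w"
  shows "rewrite_at s t k w = word w"
proof (cases "k + 2 \<le> length w")
  case True
  with assms have "rewrite_at s t k w = word (take k w @ [w ! k, w ! Suc k] @ drop (k + 2) w)"
    by (simp add: rewrite_at_def reducible_at_def rule_ordered word_mult_scaled_word)
  then show ?thesis
    using True by (simp only: split_at)
qed (simp add: rewrite_at_def)

lemma keys_add_subset:
  "Poly_Mapping.keys f \<subseteq> S \<Longrightarrow> Poly_Mapping.keys g \<subseteq> S \<Longrightarrow> Poly_Mapping.keys (f + g) \<subseteq> S"
  using keys_add[of f g] by blast

text \<open>One check over the nine types of pairs provides what is needed later: the length bound,
  the bound on the indices, and irreducibility of the replaced pair.\<close>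

lemma keys_rule:
  "Poly_Mapping.keys (rule s t x y) \<subseteq>
     {m. (m = [] \<or> length m = 2 \<and> ordered_word m) \<and> index ` set m \<subseteq> {index x, index y}}"
  by (cases x; cases y; simp add: rule_def ordered_word_pair ordered_word_Nil keys_add_subset)

lemma keys_rewrite_at:
  assumes "v \<in> Poly_Mapping.keys (rewrite_at s t k w)"
  shows "v = w \<and> length w < k + 2 \<or> k + 2 \<le> length w \<and>
    (\<exists>m. m \<in> Poly_Mapping.keys (rule s t (w ! k) (w ! Suc k)) \<and> v = take k w @ m @ drop (k + 2) w)"
proof (cases "k + 2 \<le> length w")
  case True
  let ?r = "rule s t (w ! k) (w ! Suc k)"
  have "v \<in> Poly_Mapping.keys (word (take k w) * ?r * word (drop (k + 2) w))"
    using assms True by (simp add: rewrite_at_def)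
  then obtain a b where "v = a @ b" "a \<in> Poly_Mapping.keys (word (take k w) * ?r)"
    "b = drop (k + 2) w"
    using keys_mult[of "word (take k w) * ?r" "word (drop (k + 2) w)"] by (auto simp: plus_list_def)
  moreover from this obtain m where "a = take k w @ m" "m \<in> Poly_Mapping.keys ?r"
    using keys_mult[of "word (take k w)" ?r] by (auto simp: plus_list_def)
  ultimately show ?thesis
    using True by auto
qed (use assms in \<open>simp add: rewrite_at_def\<close>)

lemma rewrite_at_length:
  assumes "v \<in> Poly_Mapping.keys (rewrite_at s t k w)"
  shows "length v \<le> length w"
proof (cases "v = w")
  case False
  with keys_rewrite_at[OF assms] obtain m where m: "k + 2 \<le> length w"
    "m \<in> Poly_Mapping.keys (rule s t (w ! k) (w ! Suc k))" "v = take k w @ m @ drop (k + 2) w"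
    by blast
  then have "length m \<le> 2"
    using keys_rule by fastforce
  then show ?thesis
    using m by simp
qed simp

text \<open>Membership in \<open>generators n\<close> depends on the index alone, so this keeps
  rewriting inside the given generators.\<close>

lemma rewrite_at_index:
  assumes "v \<in> Poly_Mapping.keys (rewrite_at s t k w)"
  shows "index ` set v \<subseteq> index ` set w"
proof (cases "v = w")
  case False
  with keys_rewrite_at[OF assms] obtain m where m: "k + 2 \<le> length w"
    "m \<in> Poly_Mapping.keys (rule s t (w ! k) (w ! Suc k))" "v = take k w @ m @ drop (k + 2) w"
    by blast
  then have "index ` set m \<subseteq> index ` {w ! k, w ! Suc k}"
    using keys_rule by fastforce
  moreover have "{w ! k, w ! Suc k} \<subseteq> set w"
    using m(1) by auto
  ultimately show ?thesis
    using m(3) set_take_subset[of k w] set_drop_subset[of "k + 2" w] by (auto 0 4)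
qed simp

text \<open>The new pair at position \<open>k\<close> is ordered. If the pair vanishes instead, at
  most one letter remains; in a longer word, deletion could bring a new unordered pair
  together.\<close>

lemma rewrite_at_not_reducible_at:
  assumes "length w \<le> 3" and v: "v \<in> Poly_Mapping.keys (rewrite_at s t k w)"
  shows "\<not> reducible_at k v"
proof (cases "k + 2 \<le> length w")
  case True
  with keys_rewrite_at[OF v] obtain m where m:
    "m \<in> Poly_Mapping.keys (rule s t (w ! k) (w ! Suc k))" "v = take k w @ m @ drop (k + 2) w"
    by auto
  from m(1) keys_rule consider "m = []" | a b where "m = [a, b]" "ordered_word [a, b]"
    by (fastforce simp: length_Suc_conv numeral_2_eq_2)
  then show ?thesis
  proof cases
    case 1
    then have "length v \<le> 1" using m(2) assms(1) True by simp
    then show ?thesis by (simp add: reducible_at_def)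
  next
    case 2
    then show ?thesis using m(2) True by (simp add: reducible_at_def nth_append)
  qed
qed (use keys_rewrite_at[OF v] in \<open>auto simp: reducible_at_def\<close>)

section \<open>Ordered words described by pairs of letters\<close>

text \<open>Splitting off the first letter turns the block condition into a condition on pairs,
  ready for the induction in \<open>ordered_word_iff\<close>.\<close>

lemma ordered_word_Cons:
  "ordered_word (x # w) \<longleftrightarrow> ordered_word w \<and> (\<forall>y\<in>set w. ordered_word [x, y])"
  (is "?L \<longleftrightarrow> ?R")
proof
  assume L: ?L
  let ?F = "\<lambda>i. filter (\<lambda>g. index g = i) w"
  have filters: "\<exists>k l. filter (\<lambda>g. index g = i) (x # w) = replicate k (A i) @ replicate l (B i) \<or>
      filter (\<lambda>g. index g = i) (x # w) = replicate k (A i) @ replicate l (C i)" for i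
    using L unfolding ordered_word_def by blast
  obtain k l where kl: "x # ?F (index x) = replicate k (A (index x)) @ replicate l (B (index x)) \<or>
      x # ?F (index x) = replicate k (A (index x)) @ replicate l (C (index x))"
    using filters[of "index x"] by auto
  have "\<exists>k l. ?F i = replicate k (A i) @ replicate l (B i) \<or>
      ?F i = replicate k (A i) @ replicate l (C i)" for i
  proof (cases "i = index x")
    case True
    show ?thesis
    \<comment> \<open>\<open>x\<close> opens its own block. If \<open>k = 0\<close>, the block
      consists of copies of \<open>x\<close> only, so \<open>l\<close> is positive and drops by one;
      otherwise \<open>x\<close> is an \<open>A\<close> and \<open>k\<close> drops.\<close>
    proof (cases k)
      case 0
      then have "?F i = replicate 0 (A i) @ replicate (l - 1) (B i) \<or>
          ?F i = replicate 0 (A i) @ replicate (l - 1) (C i)"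
        using kl True by (cases l) auto
      then show ?thesis by blast
    next
      case (Suc k')
      then show ?thesis using kl True by auto
    qed
  next
    case False
    then show ?thesis
      using filters[of i] by auto
  qed
  moreover have "ordered_word [x, y]" if "y \<in> set w" for y
  proof (cases "index x = index y")
    case True
    then have y: "y \<in> set (?F (index x))" using that by simp
    show ?thesis
    proof (cases k)
      case 0
      then have "?F (index x) = replicate (l - 1) x"
        using kl by (cases l) auto
      with y have "y = x" by (metis in_set_replicate)
      then show ?thesis by (simp add: ordered_word_pair)
    next
      case (Suc k')
      then have "x = A (index x)" and "?F (index x) = replicate k' (A (index x)) @ replicate l (B (index x)) \<or>
          ?F (index x) = replicate k' (A (index x)) @ replicate l (C (index x))"
        using kl by auto
      moreover from this have "set (?F (index x)) \<subseteq> {A (index x), B (index x), C (index x)}"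
        by (auto simp del: set_filter)
      moreover from this y have "y \<in> {A (index x), B (index x), C (index x)}"
        by blast
      ultimately show ?thesis
        by (cases x) (auto simp: ordered_word_pair)
    qed
  next
    case False
    moreover have "index x \<le> index y"
      using L that by (simp add: ordered_word_def)
    ultimately show ?thesis by (simp add: ordered_word_pair)
  qed
  moreover have "sorted (map index w)"
    using L by (simp add: ordered_word_def)
  ultimately show ?R
    unfolding ordered_word_def[of w] by blast
next
  assume R: ?R
  let ?F = "\<lambda>i. filter (\<lambda>g. index g = i) w"
  have "\<exists>k l. filter (\<lambda>g. index g = i) (x # w) = replicate k (A i) @ replicate l (B i) \<or>
      filter (\<lambda>g. index g = i) (x # w) = replicate k (A i) @ replicate l (C i)" for i
  proof -
    obtain k l D where D: "D = B i \<or> D = C i" and F: "?F i = replicate k (A i) @ replicate l D"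
      using R unfolding ordered_word_def by blast
    have o: "ordered_word [x, y]" if "y \<in> set (?F i)" for y
      using R that by auto
    show ?thesis
    proof (cases "index x = i")
      case False
      then show ?thesis using D F by auto
    next
      case True
      show ?thesis
      proof (cases "x = A i")
        case True
        then have "filter (\<lambda>g. index g = i) (x # w) = replicate (Suc k) (A i) @ replicate l D"
          using F by simp
        then show ?thesis using D by blast
      next
        case False
        \<comment> \<open>Here \<open>x\<close> is a \<open>B\<close> or a \<open>C\<close>. Such a
          letter precedes, among those of its index, only copies of itself, so the whole block
          consists of copies of \<open>x\<close>.\<close>
        have "k = 0"
          using o[of "A i"] F False \<open>index x = i\<close> by (cases k; cases x) (auto simp: ordered_word_pair)
        moreover have "l = 0 \<or> x = D"
          using o[of D] F D False \<open>index x = i\<close> by (cases l; cases x) (auto simp: ordered_word_pair)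
        ultimately have "filter (\<lambda>g. index g = i) (x # w) = replicate 0 (A i) @ replicate (Suc l) x"
          using F \<open>index x = i\<close> by auto
        moreover have "x = B i \<or> x = C i"
          using False \<open>index x = i\<close> by (cases x) auto
        ultimately show ?thesis by metis
      qed
    qed
  qed
  moreover have "index x \<le> index y" if "y \<in> set w" for y
    using R that by (force simp: ordered_word_pair)
  moreover have "sorted (map index w)"
    using R by (simp add: ordered_word_def)
  ultimately show ?L
    unfolding ordered_word_def[of "x # w"] by simp
qed

lemma ordered_word_iff: "ordered_word w \<longleftrightarrow> sorted_wrt (\<lambda>x y. ordered_word [x, y]) w"
proof (induction w)
  case (Cons x w)
  then show ?case by (simp add: ordered_word_Cons[of x w] conj_commute)
qed (simp add: ordered_word_Nil)

lemma ordered_word_imp_irreducible: "ordered_word w \<Longrightarrow> \<not> reducible_at k w"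
  by (auto simp: ordered_word_iff[of w] reducible_at_def sorted_wrt_iff_nth_less)

text \<open>Being an ordered pair is a transitive relation, so adjacent pairs suffice, and words of
  length at most three have them only at positions 0 and 1.\<close>

lemma irreducible_imp_ordered_word:
  assumes "length w \<le> 3" "\<not> reducible_at 0 w" "\<not> reducible_at 1 w"
  shows "ordered_word w"
proof -
  have tr: "ordered_word [x, z]" if "ordered_word [x, y]" "ordered_word [y, z]" for x y z
    using that by (auto simp: ordered_word_pair)
  consider "length w = 0" | "length w = 1" | "length w = 2" | "length w = 3"
    using assms(1) by linarith
  then show ?thesis
    using assms(2,3)
    by cases (auto simp: numeral_2_eq_2 numeral_3_eq_3 length_Suc_conv reducible_at_def
      ordered_word_iff[of w] ordered_word_Nil dest: tr)
qed

section \<open>The operators on elements of length at most three\<close>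

lemma rewrite_all_irreducible:
  assumes "\<And>w. w \<in> Poly_Mapping.keys f \<Longrightarrow> \<not> reducible_at k w"
  shows "rewrite_all s t k f = f"
  using assms by (intro linear_extension_id rewrite_at_irreducible)

lemma rewrite_all_ordered: "ordered f \<Longrightarrow> rewrite_all s t k f = f"
  by (rule rewrite_all_irreducible) (auto simp: ordered_def ordered_word_imp_irreducible)

definition short :: "free_alg \<Rightarrow> bool" where
  "short f \<longleftrightarrow> (\<forall>w\<in>Poly_Mapping.keys f. length w \<le> 3)"

lemma short_rewrite_all:
  assumes "short f"
  shows "short (rewrite_all s t k f)"
  unfolding short_def
proof
  fix v
  assume "v \<in> Poly_Mapping.keys (rewrite_all s t k f)"
  then obtain w where "w \<in> Poly_Mapping.keys f" "v \<in> Poly_Mapping.keys (rewrite_at s t k w)"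
    using keys_linear_extension by blast
  then show "length v \<le> 3"
    using assms rewrite_at_length[of v s t k w] unfolding short_def by fastforce
qed

lemma rewrite_all_not_reducible_at:
  assumes "short f" "v \<in> Poly_Mapping.keys (rewrite_all s t k f)"
  shows "\<not> reducible_at k v"
proof -
  obtain w where "w \<in> Poly_Mapping.keys f" "v \<in> Poly_Mapping.keys (rewrite_at s t k w)"
    using assms(2) keys_linear_extension by blast
  then show ?thesis
    using assms(1) rewrite_at_not_reducible_at[of w v s t k] by (simp add: short_def)
qed

lemma rewrite_all_idem:
  "short f \<Longrightarrow> rewrite_all s t k (rewrite_all s t k f) = rewrite_all s t k f"
  by (rule rewrite_all_irreducible) (rule rewrite_all_not_reducible_at)

text \<open>With no pair at position 1, every alternating product collapses to the operator at
  position 0. This settles the short words in \<open>braid\<close>.\<close>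

lemma rewrite_all_two_letters:
  assumes "length w \<le> 2"
  shows "rewrite_all s t 1 (word w) = word w"
    and "rewrite_all s t 1 (rewrite_all s t 0 (word w)) = rewrite_all s t 0 (word w)"
    and "rewrite_all s t 0 (rewrite_all s t 0 (word w)) = rewrite_all s t 0 (word w)"
proof -
  show "rewrite_all s t 1 (word w) = word w"
    using assms by (intro rewrite_all_irreducible) (auto simp: reducible_at_def)
  show "rewrite_all s t 1 (rewrite_all s t 0 (word w)) = rewrite_all s t 0 (word w)"
    using assms rewrite_at_length[of _ s t 0 w]
    by (intro rewrite_all_irreducible) (force simp: reducible_at_def)
  show "rewrite_all s t 0 (rewrite_all s t 0 (word w)) = rewrite_all s t 0 (word w)"
    using assms by (intro rewrite_all_idem) (simp add: short_def)
qed

section \<open>The normal form and its absorption properties\<close>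

definition normal_form :: "complex \<Rightarrow> complex \<Rightarrow> free_alg \<Rightarrow> free_alg" where
  "normal_form s t f =
     rewrite_all s t 0 (rewrite_all s t 1 (rewrite_all s t 0 (rewrite_all s t 1 f)))"

lemma normal_form_two_letters:
  "length w \<le> 2 \<Longrightarrow> normal_form s t (word w) = rewrite_all s t 0 (word w)"
  unfolding normal_form_def by (simp only: rewrite_all_two_letters)

lemma normal_form_diff: "normal_form s t (f - g) = normal_form s t f - normal_form s t g"
  and normal_form_add: "normal_form s t (f + g) = normal_form s t f + normal_form s t g"
  and normal_form_smul: "normal_form s t (c \<cdot> f) = c \<cdot> normal_form s t f"
  by (simp_all add: normal_form_def linear_extension_diff linear_extension_add linear_extension_smul)

lemma normal_form_of_ordered: "ordered f \<Longrightarrow> normal_form s t f = f"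
  by (simp add: normal_form_def rewrite_all_ordered)

text \<open>Both sides are linear, so words suffice: length three is \<open>braid_letters\<close>,
  and shorter words collapse.\<close>

lemma braid:
  assumes "s * t = 1" "short f"
  shows "normal_form s t f =
    rewrite_all s t 1 (rewrite_all s t 0 (rewrite_all s t 1 (rewrite_all s t 0 f)))"
proof -
  let ?T = "rewrite_all s t"
  have "?T 0 (?T 1 (?T 0 (rewrite_at s t 1 w))) = ?T 1 (?T 0 (?T 1 (rewrite_at s t 0 w)))"
    if w: "w \<in> Poly_Mapping.keys f" for w
  proof -
    have "?T 0 (?T 1 (?T 0 (?T 1 (word w)))) = ?T 1 (?T 0 (?T 1 (?T 0 (word w))))"
    proof (cases "length w \<le> 2")
      case True
      then show ?thesis by (simp only: rewrite_all_two_letters)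
    next
      case False
      then have "length w = 3"
        using assms(2) w by (force simp: short_def)
      then obtain x y z where "w = [x, y, z]"
        by (auto simp: numeral_3_eq_3 length_Suc_conv)
      then show ?thesis using braid_letters[OF assms(1)] by blast
    qed
    then show ?thesis by simp
  qed
  then have "linear_extension (\<lambda>w. ?T 0 (?T 1 (?T 0 (rewrite_at s t 1 w)))) f =
      linear_extension (\<lambda>w. ?T 1 (?T 0 (?T 1 (rewrite_at s t 0 w)))) f"
    by (rule linear_extension_cong)
  then show ?thesis
    by (simp add: normal_form_def linear_extension_compose)
qed

text \<open>Of the two expressions for the normal form, take the one that applies position
  \<open>k\<close> first; idempotence then absorbs the extra application.\<close>

lemma normal_form_rewrite_all:
  assumes "s * t = 1" "short f" "k < 2"
  shows "normal_form s t (rewrite_all s t k f) = normal_form s t f"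
proof -
  consider "k = 0" | "k = 1" using assms(3) by linarith
  then show ?thesis
  proof cases
    case 1
    then show ?thesis
      using assms by (simp only: braid short_rewrite_all rewrite_all_idem)
  next
    case 2
    then show ?thesis
      using assms(2) by (simp only: normal_form_def rewrite_all_idem)
  qed
qed

lemma short_normal_form: "short f \<Longrightarrow> short (normal_form s t f)"
  by (simp add: normal_form_def short_rewrite_all)

text \<open>The two expressions for the normal form end with different positions, and the last
  operator applied excludes reducibility at its position.\<close>

lemma ordered_normal_form:
  assumes "s * t = 1" "short f"
  shows "ordered (normal_form s t f)"
  unfolding ordered_def
proof
  fix w
  assume w: "w \<in> Poly_Mapping.keys (normal_form s t f)"
  have "\<not> reducible_at 0 w"
    by (rule rewrite_all_not_reducible_at[OF _ w[unfolded normal_form_def]])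
      (intro short_rewrite_all assms(2))
  moreover have "\<not> reducible_at 1 w"
    by (rule rewrite_all_not_reducible_at[OF _ w[unfolded braid[OF assms]]])
      (intro short_rewrite_all assms(2))
  moreover have "length w \<le> 3"
    using short_normal_form[OF assms(2)] w by (auto simp: short_def)
  ultimately show "ordered_word w"
    by (intro irreducible_imp_ordered_word)
qed

section \<open>Existence and uniqueness of the rewriting rules\<close>

lemma rewrite_at_two_letters: "rewrite_at s t 0 [x, y] = rule s t x y"
  by (simp add: rewrite_at_def word_Nil)

lemma rewrite_all_relations:
  assumes "q \<noteq> 0" "(l, r) \<in> relations n q"
  shows "rewrite_all (q^2) (inverse (q^2)) 0 l = rewrite_all (q^2) (inverse (q^2)) 0 r"
  using assms(2)
proof (induction rule: relations.induct)
qed (rule poly_mapping_eqI, use assms(1) in \<open>auto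
      simp: linear_extension_add linear_extension_diff linear_extension_scaled_word smul_scaled_word
      rewrite_at_two_letters rewrite_at_def[of _ _ _ "[]"] rule_def
      lookup_add lookup_minus lookup_smul lookup_scaled_word field_simps power2_eq_square\<close>)+

text \<open>Membership in a span could allow several right-hand sides. Applying the operator at
  position 0 to \<open>word [x, y] - p\<close> gives both zero and \<open>rule\<close> minus
  \<open>p\<close>.\<close>

lemma rewrite_rule_imp_rule:
  assumes "q \<noteq> 0" "rewrite_rule (relations n q) [x, y] p"
  shows "p = rule (q^2) (inverse (q^2)) x y"
proof -
  let ?T = "rewrite_all (q^2) (inverse (q^2)) 0"
  have "?T d = 0" if "d \<in> free_alg.span {l - r | l r. (l, r) \<in> relations n q}" for d
    using that
  proof (induction rule: free_alg.span_induct_alt)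
    case base
    show ?case by (simp add: linear_extension_def)
  next
    case (step c d e)
    then show ?case
      using rewrite_all_relations[OF assms(1)]
      by (auto simp: linear_extension_add linear_extension_smul linear_extension_diff)
  qed
  moreover have "word [x, y] - p \<in> free_alg.span {l - r | l r. (l, r) \<in> relations n q}"
    and p: "ordered p"
    using assms(2) by (simp_all only: rewrite_rule_def)
  ultimately have "?T (word [x, y] - p) = 0"
    by blast
  then have "?T (word [x, y]) - ?T p = 0"
    by (simp only: linear_extension_diff)
  moreover have "?T p = p"
    by (rule rewrite_all_ordered[OF p])
  ultimately show ?thesis
    by (simp add: rewrite_at_two_letters)
qed

text \<open>The solved forms only have to supply some right-hand side; uniqueness identifies it with
  \<open>rule\<close>, so no formulas are compared.\<close>

lemma rewrite_rule_rule:
  assumes "q \<noteq> 0" "x \<in> generators n" "y \<in> generators n" "\<not> ordered_word [x, y]"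
  shows "rewrite_rule (relations n q) [x, y] (rule (q^2) (inverse (q^2)) x y)"
proof -
  have "\<exists>p. rewrite_rule (relations n q) [x, y] p"
  proof (cases "index x = index y")
    case True
    then show ?thesis
      using assms(2-4) rewrite_rules_equal_index[OF assms(1), of "index x" n]
      by (cases x; cases y) (auto simp: ordered_word_pair generators_def)
  next
    case False
    then have "index y < index x"
      using assms(4) by (auto simp: ordered_word_pair)
    moreover have "1 \<le> index y" "index x \<le> n - 1"
      using assms(2,3) by (auto simp: generators_def)
    ultimately show ?thesis
      using rewrite_rules_unequal_index[OF assms(1), of "index y" "index x" n]
      by (cases x; cases y) auto
  qed
  then show ?thesis
    using rewrite_rule_imp_rule[OF assms(1)] by blast
qed

section \<open>Rewriting steps compared with the operators\<close>

text \<open>Letters are tracked along with length, because rules are available only for the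
  generators in range.\<close>

definition short_over :: "gen set \<Rightarrow> free_alg \<Rightarrow> bool" where
  "short_over G f \<longleftrightarrow> (\<forall>w\<in>Poly_Mapping.keys f. length w \<le> 3 \<and> set w \<subseteq> G)"

lemma short_overD: "short_over G f \<Longrightarrow> short f"
  by (simp add: short_over_def short_def)

lemma short_over_word: "length w \<le> 3 \<Longrightarrow> set w \<subseteq> G \<Longrightarrow> short_over G (word w)"
  by (simp add: short_over_def)

lemma short_over_rewrite_at:
  assumes "length w \<le> 3" "set w \<subseteq> generators n"
  shows "short_over (generators n) (rewrite_at s t k w)"
  unfolding short_over_def
proof
  fix v
  assume v: "v \<in> Poly_Mapping.keys (rewrite_at s t k w)"
  have "g \<in> generators n" if "g \<in> set v" for g
  proof -
    have "index g \<in> index ` set w"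
      using rewrite_at_index[OF v] that by blast
    then obtain h where "h \<in> set w" "index g = index h"
      by blast
    then show ?thesis
      using assms(2) by (auto simp: generators_def)
  qed
  with rewrite_at_length[OF v] assms(1) show "length v \<le> 3 \<and> set v \<subseteq> generators n"
    by auto
qed

lemma keys_replace:
  assumes "w \<in> Poly_Mapping.keys f"
  shows "Poly_Mapping.keys (f - c \<star> w + d \<cdot> g) \<subseteq> Poly_Mapping.keys f \<union> Poly_Mapping.keys g"
proof
  fix v
  assume "v \<in> Poly_Mapping.keys (f - c \<star> w + d \<cdot> g)"
  with assms show "v \<in> Poly_Mapping.keys f \<union> Poly_Mapping.keys g"
    by (cases "v = w") (auto simp: in_keys_iff lookup_add lookup_minus lookup_smul lookup_single)
qed

lemma short_over_replace:
  assumes "short_over G f" "short_over G g" "w \<in> Poly_Mapping.keys f"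
  shows "short_over G (f - c \<star> w + c \<cdot> g)"
  using assms(1,2) keys_replace[OF assms(3), of c c g] by (auto simp: short_over_def)

lemma short_over_rewrite_all:
  "short_over (generators n) f \<Longrightarrow> short_over (generators n) (rewrite_all s t k f)"
  using keys_linear_extension[of "rewrite_at s t k" f] short_over_rewrite_at[of _ n s t k]
  unfolding short_over_def by blast

text \<open>A step replaces one word by its image under \<open>rewrite_at\<close>, and the normal
  form takes equal values on both.\<close>

lemma rewrite_step_normal_form:
  assumes q: "q \<noteq> 0" and step: "rewrite_step (relations n q) f g"
    and f: "short_over (generators n) f"
  shows "short_over (generators n) g"
    and "normal_form (q^2) (inverse (q^2)) g = normal_form (q^2) (inverse (q^2)) f"
proof -
  let ?N = "normal_form (q^2) (inverse (q^2))"
  let ?r = "rewrite_at (q^2) (inverse (q^2))"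
  obtain m p c u v where m: "rewrite_rule (relations n q) m p"
    and c: "c = Poly_Mapping.lookup f (u @ m @ v)" "c \<noteq> 0"
    and g: "g = f - c \<star> (u @ m @ v) + c \<cdot> (word u * p * word v)"
    using step by (auto elim!: rewrite_step.cases)
  define w where "w = u @ m @ v"
  obtain x y where xy: "m = [x, y]"
    using m by (auto simp: rewrite_rule_def numeral_2_eq_2 length_Suc_conv)
  have "p = rule (q^2) (inverse (q^2)) x y"
    using rewrite_rule_imp_rule[OF q] m xy by simp
  then have p: "word u * p * word v = ?r (length u) w"
    by (simp add: rewrite_at_def w_def xy nth_append)
  have w: "w \<in> Poly_Mapping.keys f"
    using c by (simp add: w_def in_keys_iff)
  then have W: "length w \<le> 3" "set w \<subseteq> generators n"
    using f by (auto simp: short_over_def)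
  show "short_over (generators n) g"
    unfolding g p using short_over_replace[OF f short_over_rewrite_at[OF W] w]
    by (simp add: w_def)
  have "length u < 2"
    \<comment> \<open>The rewritten pair occupies two of at most three letters, so it sits at
      position 0 or 1.\<close>
    using W(1) by (simp add: w_def xy)
  then have "?N (rewrite_all (q^2) (inverse (q^2)) (length u) (word w)) = ?N (word w)"
    using q W(1) by (intro normal_form_rewrite_all) (auto simp: short_def)
  then have "?N (?r (length u) w) = ?N (word w)"
    by simp
  moreover have "?N (c \<star> w) = c \<cdot> ?N (word w)"
    using normal_form_smul[of _ _ c "word w"] by (simp add: smul_scaled_word)
  ultimately show "?N g = ?N f"
    unfolding g p w_def[symmetric] by (simp add: normal_form_add normal_form_diff normal_form_smul)
qed

lemma rewrite_steps_normal_form: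
  assumes q: "q \<noteq> 0" and "(rewrite_step (relations n q))\<^sup>*\<^sup>* f g" "short_over (generators n) f"
  shows "short_over (generators n) g \<and>
    normal_form (q^2) (inverse (q^2)) g = normal_form (q^2) (inverse (q^2)) f"
  using assms(2,3)
proof induction
  case (step g h)
  then show ?case
    using rewrite_step_normal_form[OF q step.hyps(2)] by simp
qed simp

text \<open>The words of the support that are reducible at \<open>k\<close> are rewritten one at a
  time, by induction on their number.\<close>

lemma rewrite_steps_rewrite_all:
  assumes q: "q \<noteq> 0" and "short_over (generators n) f"
  shows "(rewrite_step (relations n q))\<^sup>*\<^sup>* f (rewrite_all (q^2) (inverse (q^2)) k f)"
  using assms(2)
proof (induction "card {w \<in> Poly_Mapping.keys f. reducible_at k w}" arbitrary: f rule: less_induct)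
  case less
  let ?r = "rewrite_at (q^2) (inverse (q^2)) k"
  let ?T = "rewrite_all (q^2) (inverse (q^2)) k"
  show ?case
  proof (cases "\<exists>w\<in>Poly_Mapping.keys f. reducible_at k w")
    case False
    then have "?T f = f"
      by (intro rewrite_all_irreducible) blast
    then show ?thesis by simp
  next
    case True
    then obtain w where w: "w \<in> Poly_Mapping.keys f" "reducible_at k w"
      by blast
    let ?c = "Poly_Mapping.lookup f w"
    let ?g = "f - ?c \<star> w + ?c \<cdot> ?r w"
    have k: "k + 2 \<le> length w" and W: "length w \<le> 3" "set w \<subseteq> generators n"
      using w less.prems by (auto simp: reducible_at_def short_over_def)
    have "rewrite_rule (relations n q) [w ! k, w ! Suc k]
        (rule (q^2) (inverse (q^2)) (w ! k) (w ! Suc k))"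
      using w(2) k W(2) by (intro rewrite_rule_rule[OF q]) (auto simp: reducible_at_def)
    from rewrite_step.intros[OF this refl, of f "take k w" "drop (k + 2) w"]
    have step: "rewrite_step (relations n q) f ?g"
      using w(1) k by (simp only: split_at) (simp add: rewrite_at_def in_keys_iff)
    have irr: "\<not> reducible_at k v" if "v \<in> Poly_Mapping.keys (?r w)" for v
      using rewrite_at_not_reducible_at[OF W(1) that] .
    \<comment> \<open>The replacement contains no word reducible at \<open>k\<close>, hence not
      \<open>w\<close> itself, so the count strictly drops.\<close>
    have "Poly_Mapping.lookup (?r w) w = 0"
      using irr w(2) by (auto simp: in_keys_iff)
    then have "w \<notin> Poly_Mapping.keys ?g"
      by (simp add: in_keys_iff lookup_add lookup_minus lookup_smul)
    moreover have "Poly_Mapping.keys ?g \<subseteq> Poly_Mapping.keys f \<union> Poly_Mapping.keys (?r w)"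
      by (rule keys_replace[OF w(1)])
    ultimately have "{v \<in> Poly_Mapping.keys ?g. reducible_at k v} \<subset>
        {v \<in> Poly_Mapping.keys f. reducible_at k v}"
      using irr w by blast
    then have "card {v \<in> Poly_Mapping.keys ?g. reducible_at k v} <
        card {v \<in> Poly_Mapping.keys f. reducible_at k v}"
      by (intro psubset_card_mono) auto
    moreover have "short_over (generators n) ?g"
      by (rule short_over_replace[OF less.prems short_over_rewrite_at[OF W] w(1)])
    ultimately have "(rewrite_step (relations n q))\<^sup>*\<^sup>* ?g (?T ?g)"
      by (rule less.hyps)
    \<comment> \<open>The target is unchanged by the step, since \<open>?T\<close> sends
      \<open>w\<close> to \<open>?r w\<close> and fixes \<open>?r w\<close>.\<close>
    moreover have "?T ?g = ?T f"
    proof -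
      have "?T (?r w) = ?r w"
        by (rule rewrite_all_irreducible) (rule irr)
      then show ?thesis
        by (simp add: linear_extension_add linear_extension_diff linear_extension_smul
          linear_extension_scaled_word)
    qed
    ultimately show ?thesis
      using step by (metis converse_rtranclp_into_rtranclp)
  qed
qed

section \<open>Unique reordering and the Jacobi relation\<close>

text \<open>Uniqueness: steps preserve the normal form, which fixes ordered elements. Existence:
  each of the four operators composing it is realised by steps, and the result is ordered.\<close>

lemma reorders_to_iff_normal_form:
  assumes q: "q \<noteq> 0" and f: "short_over (generators n) f"
  shows "reorders_to (relations n q) f g \<longleftrightarrow> g = normal_form (q^2) (inverse (q^2)) f"
proof
  assume "reorders_to (relations n q) f g"
  then have "(rewrite_step (relations n q))\<^sup>*\<^sup>* f g" "ordered g"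
    by (auto simp: reorders_to_def)
  then show "g = normal_form (q^2) (inverse (q^2)) f"
    using rewrite_steps_normal_form[OF q _ f] normal_form_of_ordered by metis
next
  assume g: "g = normal_form (q^2) (inverse (q^2)) f"
  let ?T = "rewrite_all (q^2) (inverse (q^2))"
  have step: "(rewrite_step (relations n q))\<^sup>*\<^sup>* f (?T k h)"
    if "(rewrite_step (relations n q))\<^sup>*\<^sup>* f h" "short_over (generators n) h" for h k
    using that(1) rewrite_steps_rewrite_all[OF q that(2)] by (rule rtranclp_trans)
  have "(rewrite_step (relations n q))\<^sup>*\<^sup>* f g"
    unfolding g normal_form_def by (intro step short_over_rewrite_all f rtranclp.rtrancl_refl)
  moreover have "ordered g"
    unfolding g using q f by (intro ordered_normal_form short_overD) auto
  ultimately show "reorders_to (relations n q) f g"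
    by (simp add: reorders_to_def)
qed

theorem proposition7:
  fixes n :: nat and hbar :: real and q :: complex
  assumes "n \<ge> 2" and "hbar > 0"
    and "q = exp (\<i> * of_real pi * of_real hbar)"
  shows "quantum_jacobi (generators n) (relations n q)"
  unfolding quantum_jacobi_def
proof (intro ballI)
  fix x y z
  assume G: "x \<in> generators n" "y \<in> generators n" "z \<in> generators n"
  have q: "q \<noteq> 0" using assms(3) by simp
  let ?N = "normal_form (q^2) (inverse (q^2))"
  let ?T = "rewrite_all (q^2) (inverse (q^2))"
  let ?r = "rule (q^2) (inverse (q^2))"
  \<comment> \<open>Starting with the left pair means \<open>k = 0\<close>, with the right pair
    \<open>k = 1\<close>; absorption makes the final result independent of \<open>k\<close>.\<close>
  have N: "reorders_to (relations n q) (?T k (word [x, y, z])) s \<longleftrightarrow> s = ?N (word [x, y, z])"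
    if "k < 2" for k s
  proof -
    have w: "short_over (generators n) (word [x, y, z])"
      using G by (intro short_over_word) auto
    have "?N (?T k (word [x, y, z])) = ?N (word [x, y, z])"
      using q that by (intro normal_form_rewrite_all short_overD[OF w]) auto
    then show ?thesis
      using reorders_to_iff_normal_form[OF q short_over_rewrite_all[OF w]] by metis
  qed
  \<comment> \<open>The intermediate \<open>p\<close> is thus determined, which removes the
    existential quantifier from both ways of reordering.\<close>
  have P: "reorders_to (relations n q) (word [a, b]) p \<longleftrightarrow> p = ?r a b"
    if "a \<in> generators n" "b \<in> generators n" for a b p
    using that
    by (subst reorders_to_iff_normal_form[OF q])
      (auto simp: short_over_word normal_form_two_letters rewrite_at_two_letters)
  have "reorders_left_first (relations n q) x y z s \<longleftrightarrow> s = ?N (word [x, y, z])" for s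
    unfolding reorders_left_first_def P[OF G(1,2)] using N[of 0 s] by (simp add: rewrite_at_simps)
  moreover have "reorders_right_first (relations n q) x y z s \<longleftrightarrow> s = ?N (word [x, y, z])" for s
    unfolding reorders_right_first_def P[OF G(2,3)] using N[of 1 s] by (simp add: rewrite_at_simps)
  ultimately show "\<exists>r. {s. reorders_left_first (relations n q) x y z s} = {r} \<and>
      {s. reorders_right_first (relations n q) x y z s} = {r}"
    by auto
qed

end
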